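(* Let the probability measure $\mathbb{P}$ on $\mathbb{R}^d$ be $\delta$-good and let $f^*:\mathrm{supp}(\mathbb{P})\rightarrow\mathbb{R}^{d'}$ be a target function, assumed to be Lipschitz. Let $N\in\mathbb{N}$ and let $0<\epsilon<1$. Then with probability at least $1-\epsilon$ over all i.i.d. samples $(x_1,\dots,x_N)$ from $\mathbb{P}$, any Lipschitz function $f:\mathbb{R}^d\rightarrow\mathbb{R}^{d'}$ which coincides with $f^*$ on $(x_1,\dots,x_N)$ satisfies $$\mathbb{E}_{x\sim\mathbb{P}}\|f(x)-f^*(x)\|_2\leq\delta(N,\epsilon)\Big(\|f^*\|_{Lip,\mathbb{P}}+\max_i\big(\|Jf(x_i)\|_2+V_{B(x_i,\delta(N,\epsilon))}(Jf)\big)\Big).$$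
   Context: $\mathbb{R}_{>0}$ denotes the positive reals, and $B(x,r)\subset\mathbb{R}^d$ denotes the closed Euclidean ball of radius $r$ centred at $x$. For a probability measure $\mathbb{P}$ on $\mathbb{R}^d$, $\mathrm{supp}(\mathbb{P})$ is its support, regarded as a metric space with the metric inherited from $\mathbb{R}^d$. For a Lipschitz function $g$, $\|g\|_{Lip,\mathbb{P}}$ denotes the Lipschitz norm (best Lipschitz constant) of $g|_{\mathrm{supp}(\mathbb{P})}$. $Jf$ denotes the Jacobian (derivative) of $f$, and $\|Jf(x)\|_2$ its spectral norm. Convention: pointwise evaluations of the derivative of a Lipschitz function rely on the fact that the evaluations are probabilistic and Lipschitz functions are differentiable almost everywhere. For a locally bounded (not necessarily continuous) function $g$ on $\mathbb{R}^d$ and a compact set $S\subset\mathbb{R}^d$, the local variation of $g$ over $S$ is $V_S(g):=\sup_{x,y\in S}\|g(x)-g(y)\|_2$, where $\|\cdot\|_2$ is the Euclidean norm if $g$ is vector-valued and the spectral norm if $g$ is operator-valued (such as $g=Jf$). Definition ($\delta$-good). Let $\delta:\mathbb{N}\times(0,1)\rightarrow\mathbb{R}_{>0}$ be a function such that for each $\epsilon\in(0,1)$ the function $N\mapsto\delta(N,\epsilon)$ is decreasing and vanishes as $N\rightarrow\infty$. A probability distribution $\mathbb{P}$ is $\delta$-good if for every $N\in\mathbb{N}$ and $\epsilon\in(0,1)$, with probability at least $1-\epsilon$ over i.i.d. samples $(x_1,\dots,x_N)$ from $\mathbb{P}$, one has $\mathrm{supp}(\mathbb{P})\subset\bigcup_{i=1}^N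 B(x_i,\delta(N,\epsilon))$. *)

theory Defs
  imports "HOL-Probability.Probability"
begin

definition supp :: "'a::topological_space measure \<Rightarrow> 'a set" where
  "supp P = {x. \<forall>U. open U \<longrightarrow> x \<in> U \<longrightarrow> emeasure P U > 0}"

text \<open>The event \<open>Q\<close> is not assumed measurable: it has to contain a measurable event of
  probability at least \<open>p\<close>. For measurable \<open>Q\<close> this is \<open>measure M {\<omega> \<in> space M. Q \<omega>} \<ge> p\<close>.\<close>

definition with_prob_at_least :: "real \<Rightarrow> 'a measure \<Rightarrow> ('a \<Rightarrow> bool) \<Rightarrow> bool" where
  "with_prob_at_least p M Q \<longleftrightarrow> (\<exists>E\<in>sets M. measure M E \<ge> p \<and> (\<forall>\<omega>\<in>E. Q \<omega>))"

definition iid_samples :: "nat \<Rightarrow> 'a measure \<Rightarrow> (nat \<Rightarrow> 'a) measure" where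
  "iid_samples N P = (\<Pi>\<^sub>M i\<in>{1..N}. P)"

text \<open>Sample sizes are positive: no distribution could satisfy the covering condition with
  an empty sample.\<close>

definition rate_function :: "(nat \<Rightarrow> real \<Rightarrow> real) \<Rightarrow> bool" where
  "rate_function \<delta> \<longleftrightarrow>
     (\<forall>\<epsilon>\<in>{0<..<1}. (\<forall>N\<ge>1. \<delta> N \<epsilon> > 0) \<and>
        (\<forall>M N. 1 \<le> M \<longrightarrow> M \<le> N \<longrightarrow> \<delta> N \<epsilon> \<le> \<delta> M \<epsilon>) \<and>
        (\<lambda>N. \<delta> N \<epsilon>) \<longlonglongrightarrow> 0)"

definition delta_good :: "(nat \<Rightarrow> real \<Rightarrow> real) \<Rightarrow> 'a::metric_space measure \<Rightarrow> bool" where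
  "delta_good \<delta> P \<longleftrightarrow> rate_function \<delta> \<and>
     (\<forall>N\<ge>1. \<forall>\<epsilon>\<in>{0<..<1}. with_prob_at_least (1 - \<epsilon>) (iid_samples N P)
        (\<lambda>x. supp P \<subseteq> (\<Union>i\<in>{1..N}. cball (x i) (\<delta> N \<epsilon>))))"

definition Lip_norm :: "'a::metric_space measure \<Rightarrow> ('a \<Rightarrow> 'b::metric_space) \<Rightarrow> real" where
  "Lip_norm P g = Inf {L. L-lipschitz_on (supp P) g}"

definition local_variation :: "'a set \<Rightarrow> ('a \<Rightarrow> 'b::real_normed_vector) \<Rightarrow> real" where
  "local_variation S g = (SUP (x, y) \<in> S \<times> S. norm (g x - g y))"

text \<open>The derivative of a Lipschitz function is a partial function, defined almost everywhere.
  \<open>jacobian_version f A J\<close> says that \<open>J\<close>, regarded as a locally bounded function with domain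
  \<open>A\<close>, is the derivative of \<open>f\<close> wherever \<open>f\<close> is differentiable. The smallest choice of \<open>A\<close> is
  the set of points of differentiability; larger \<open>A\<close>, up to \<open>UNIV\<close>, allow arbitrary values at
  some or all of the remaining points. The norm of \<open>J x\<close> is the operator norm for the Euclidean
  norms, i.e. the spectral norm.\<close>

definition jacobian_version ::
  "('a::real_normed_vector \<Rightarrow> 'b::real_normed_vector) \<Rightarrow> 'a set \<Rightarrow> ('a \<Rightarrow> 'a \<Rightarrow>\<^sub>L 'b) \<Rightarrow> bool" where
  "jacobian_version f A J \<longleftrightarrow>
     (\<forall>x. f differentiable (at x) \<longrightarrow> x \<in> A \<and> (f has_derivative blinfun_apply (J x)) (at x)) \<and>
     (\<forall>K. compact K \<longrightarrow> bounded (J ` (K \<inter> A)))"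

end

theory Submission
  imports Defs
begin

text \<open>Almost surely all samples lie in the support, and on the covering event every point \<open>y\<close> of the
  support is within \<open>\<delta>\<close> of some sample \<open>x i\<close>, where \<open>f\<close> and \<open>f*\<close> agree. So it suffices that \<open>f\<close> is
  Lipschitz on the ball around \<open>x i\<close> with the supremum of the norms of its derivatives as constant,
  which needs Rademacher's theorem.

  Both rest on one estimate. If the lower right Dini derivative of \<open>f\<close> in direction \<open>v\<close> is below
  \<open>r\<close> on a closed set \<open>K\<close>, then along a segment \<open>f\<close> grows at rate at most \<open>r\<close>, up to an error
  proportional to the time the segment spends outside \<open>K\<close>; averaging over the starting points
  makes this error small. Applied to small translates of a compact set \<open>K\<close>, this shows that
  right directional derivatives exist and are additive in \<open>v\<close> almost everywhere, without a covering or
  differentiation theorem.\<close>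

section \<open>Increments of Lipschitz functions\<close>

text \<open>Only a lower Dini bound on \<open>C\<close> is needed: after subtracting the right-hand side, every
  point of \<open>[0, T)\<close> has a point to its right at which the value is not larger, and the last
  point below the initial value is \<open>T\<close>.\<close>

lemma frequent_slope_bound:
  fixes \<phi> :: "real \<Rightarrow> real"
  assumes lip: "L-lipschitz_on UNIV \<phi>" and C: "closed C"
    and slope: "\<And>s. s \<in> C \<Longrightarrow> \<exists>\<^sub>F h in at_right 0. \<phi> (s + h) - \<phi> s < r * h"
    and c: "0 \<le> c" "L - r \<le> c" and T: "0 \<le> T"
  shows "\<phi> T - \<phi> 0 \<le> r * T + c * measure lborel ({0..T} - C)"
proof -
  define m where "m t = measure lborel ({0..t} - C)" for t
  define \<psi> where "\<psi> t = \<phi> t - r * t - c * m t" for t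
  have borel_C: "C \<in> sets borel" using C by auto
  have fmeas: "{a..b} \<in> fmeasurable lborel" "{a<..b} \<in> fmeasurable lborel" for a b :: real
    by (cases "a \<le> b"; auto intro!: fmeasurableI)+
  have fm: "{a..b} - C \<in> fmeasurable lborel" "{a<..b} - C \<in> fmeasurable lborel" for a b :: real
    using borel_C by (auto intro!: fmeasurable_Diff fmeas)
  have m_add: "m (t + h) = m t + measure lborel ({t<..t+h} - C)" if "0 \<le> t" "0 \<le> h" for t h
  proof -
    have "{0..t+h} - C = ({0..t} - C) \<union> ({t<..t+h} - C)"
      using that by auto
    moreover have "({0..t} - C) \<inter> ({t<..t+h} - C) = {}" by auto
    ultimately show ?thesis unfolding m_def
      using measure_Un3[OF fm(1) fm(2), of 0 t t "t+h"] by (metis diff_zero measure_empty)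
  qed
  have m_le: "measure lborel ({t<..t+h} - C) \<le> h" if "0 \<le> h" for t h
  proof -
    have "measure lborel ({t<..t+h} - C) \<le> measure lborel {t<..t+h}"
      using fmeas fm borel_C by (intro measure_mono_fmeasurable) (auto simp del: fmeasurable_Diff)
    then show ?thesis using that by simp
  qed
  have m_le': "m (t + h) \<le> m t + h" if "0 \<le> t" "0 \<le> h" for t h
    using m_add[OF that] m_le[of h t] that by simp
  have m_mono: "m t \<le> m (t + h)" if "0 \<le> t" "0 \<le> h" for t h
    using m_add[OF that] by simp
  have "1-lipschitz_on {0..T} m"
  proof (rule lipschitz_on_leI)
    fix x y assume "x \<in> {0..T}" "y \<in> {0..T}" "x \<le> y"
    then show "dist (m x) (m y) \<le> 1 * dist x y"
      using m_le'[of x "y - x"] m_mono[of x "y - x"] by (auto simp: dist_real_def)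
  qed auto
  then have "continuous_on {0..T} m" by (rule lipschitz_on_continuous_on)
  moreover have "continuous_on {0..T} \<phi>"
    using lipschitz_on_continuous_on[OF lip] continuous_on_subset by blast
  ultimately have cont: "continuous_on {0..T} \<psi>"
    unfolding \<psi>_def by (intro continuous_intros) auto
  \<comment> \<open>On \<open>C\<close> the slope assumption supplies \<open>h\<close>. Off
    \<open>C\<close> an interval to the right of \<open>t\<close> misses \<open>C\<close>; there
    \<open>m\<close> grows at rate 1, and \<open>c\<close> is large enough to absorb a growth of
    \<open>\<phi>\<close> at rate \<open>L\<close>.\<close>
  have step: "\<exists>h>0. t + h \<le> T \<and> \<psi> (t + h) \<le> \<psi> t" if t: "0 \<le> t" "t < T" for t
  proof (cases "t \<in> C")
    case True
    have "\<forall>\<^sub>F h in at_right 0. h \<in> {0<..<T - t}"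
      using t by (intro eventually_at_right_real) auto
    from frequently_ex[OF frequently_eventually_conj[OF slope[OF True] this]]
    obtain h where h: "0 < h" "h < T - t" "\<phi> (t + h) - \<phi> t < r * h" by auto
    have "c * m t \<le> c * m (t + h)" using m_mono[of t h] t h c by (intro mult_left_mono) auto
    then show ?thesis using h by (intro exI[of _ h]) (auto simp: \<psi>_def algebra_simps)
  next
    case False
    then obtain d where d: "d > 0" "ball t d \<subseteq> - C"
      using C by (metis ComplI open_Compl open_contains_ball)
    define h where "h = min (d/2) (T - t)"
    have h: "0 < h" "h < d" "t + h \<le> T" using d t by (auto simp: h_def min_def)
    have "{t<..t+h} - C = {t<..t+h}"
      using d(2) h by (force simp: dist_real_def)
    then have "m (t + h) = m t + h" using m_add[of t h] t h by simp
    moreover have "\<phi> (t + h) - \<phi> t \<le> L * h"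
      using lipschitz_onD[OF lip, of "t+h" t] h by (auto simp: dist_real_def)
    moreover have "(L - r) * h \<le> c * h" using c h by (intro mult_right_mono) auto
    ultimately show ?thesis using h
      by (intro exI[of _ h]) (auto simp: \<psi>_def algebra_simps)
  qed
  have "compact ({0..T} \<inter> \<psi> -` {..\<psi> 0})"
    using continuous_closed_preimage[OF cont, of "{..\<psi> 0}"]
    by (auto simp: compact_eq_bounded_closed intro: bounded_subset[of "{0..T}"])
  moreover have "{0..T} \<inter> \<psi> -` {..\<psi> 0} \<noteq> {}" using T by auto
  ultimately obtain s where s: "s \<in> {0..T} \<inter> \<psi> -` {..\<psi> 0}"
      and max: "\<And>t. t \<in> {0..T} \<inter> \<psi> -` {..\<psi> 0} \<Longrightarrow> t \<le> s"
    using compact_attains_sup[of "{0..T} \<inter> \<psi> -` {..\<psi> 0}"] by metis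
  have "s = T"
  proof (rule ccontr)
    assume "s \<noteq> T"
    then obtain h where "h > 0" "s + h \<le> T" "\<psi> (s + h) \<le> \<psi> s" using step[of s] s by auto
    then show False using max[of "s + h"] s by auto
  qed
  moreover have "c * m 0 = 0"
  proof -
    have "m 0 \<le> measure lborel {0::real}"
      unfolding m_def using borel_C fmeas(1)[of 0 0] by (intro measure_mono_fmeasurable) auto
    then show ?thesis by (simp add: m_def measure_le_0_iff)
  qed
  ultimately show ?thesis using s by (auto simp: \<psi>_def m_def)
qed

section \<open>Increments along a vector, averaged over the starting point\<close>

text \<open>It follows if the lower right Dini derivative in direction \<open>v\<close> is below
  \<open>r\<close>, and it implies that this derivative is at most \<open>r\<close>.\<close>

definition dini_less :: "('a::real_vector \<Rightarrow> real) \<Rightarrow> 'a \<Rightarrow> real \<Rightarrow> 'a \<Rightarrow> bool" where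
  "dini_less f v r x \<longleftrightarrow> (\<exists>\<^sub>F t in at_right 0. f (x + t *\<^sub>R v) - f x < r * t)"

text \<open>On the line through \<open>x\<close> in direction \<open>v\<close> the function
  \<open>f\<close> is Lipschitz with constant \<open>L * norm v\<close>, and \<open>K\<close> cuts a
  closed set out of this line, so the one-dimensional bound applies.\<close>

lemma dini_less_segment:
  fixes f :: "'a::euclidean_space \<Rightarrow> real"
  assumes lip: "L-lipschitz_on UNIV f" and K: "closed K"
    and slope: "\<And>x. x \<in> K \<Longrightarrow> dini_less f v r x"
    and c: "0 \<le> c" "L * norm v - r \<le> c" and t: "0 \<le> t"
  shows "f (x + t *\<^sub>R v) - f x \<le> r * t + c * measure lborel {s \<in> {0..t}. x + s *\<^sub>R v \<notin> K}"
proof -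
  have "L \<ge> 0" using lip by (rule lipschitz_on_nonneg)
  have "(L * norm v)-lipschitz_on UNIV (\<lambda>s. f (x + s *\<^sub>R v))"
  proof (rule lipschitz_onI)
    fix s s' :: real
    have "dist (f (x + s *\<^sub>R v)) (f (x + s' *\<^sub>R v)) \<le> L * norm ((s - s') *\<^sub>R v)"
      using lipschitz_onD[OF lip, of "x + s *\<^sub>R v" "x + s' *\<^sub>R v"]
      by (simp add: dist_norm scaleR_diff_left)
    then show "dist (f (x + s *\<^sub>R v)) (f (x + s' *\<^sub>R v)) \<le> L * norm v * dist s s'"
      by (simp add: dist_norm mult_ac)
  qed (use \<open>L \<ge> 0\<close> in auto)
  moreover have "closed ((\<lambda>s. x + s *\<^sub>R v) -` K)"
    using K by (intro closed_vimage continuous_intros)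
  moreover have "\<exists>\<^sub>F h in at_right 0. f (x + (s + h) *\<^sub>R v) - f (x + s *\<^sub>R v) < r * h"
    if "s \<in> (\<lambda>s. x + s *\<^sub>R v) -` K" for s
    using slope[of "x + s *\<^sub>R v"] that by (simp add: dini_less_def algebra_simps)
  ultimately have "f (x + t *\<^sub>R v) - f (x + 0 *\<^sub>R v)
      \<le> r * t + c * measure lborel ({0..t} - (\<lambda>s. x + s *\<^sub>R v) -` K)"
    using c t by (rule frequent_slope_bound)
  moreover have "{0..t} - (\<lambda>s. x + s *\<^sub>R v) -` K = {s \<in> {0..t}. x + s *\<^sub>R v \<notin> K}" by auto
  ultimately show ?thesis by simp
qed

text \<open>By Tonelli, the time spent outside \<open>K\<close>, integrated over the starting points
  in \<open>B\<close>, is the integral over the times \<open>s\<close> of the measure of the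
  starting points that are outside \<open>K\<close> at time \<open>s\<close>; hence it is at most
  \<open>\<eta> * t\<close>.\<close>

lemma integral_increment_le:
  fixes f :: "'a::euclidean_space \<Rightarrow> real"
  assumes lip: "L-lipschitz_on UNIV f" and K: "closed K" and B: "compact B"
    and slope: "\<And>x. x \<in> K \<Longrightarrow> dini_less f v r x"
    and c: "0 \<le> c" "L * norm v - r \<le> c" and t: "0 \<le> t" and "0 \<le> \<eta>"
    and escape: "\<And>s. s \<in> {0..t} \<Longrightarrow> emeasure lborel {x \<in> B. x + s *\<^sub>R v \<notin> K} \<le> ennreal \<eta>"
  shows "(LINT x:B|lborel. f (x + t *\<^sub>R v) - f x) \<le> r * t * measure lborel B + c * t * \<eta>"
proof -
  have cont: "continuous_on UNIV f" using lip by (rule lipschitz_on_continuous_on)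
  define m where "m x = measure lborel {s \<in> {0..t}. x + s *\<^sub>R v \<notin> K}" for x
  have borel[measurable]: "K \<in> sets borel" "B \<in> sets borel"
    using K compact_imp_closed[OF B] by auto
  have fB: "emeasure lborel B < \<infinity>" using B by (rule emeasure_compact_finite)
  define A where "A = {p \<in> space (lborel \<Otimes>\<^sub>M lborel). fst p \<in> B \<and> snd p \<in> {0..t} \<and> fst p + snd p *\<^sub>R v \<notin> K}"
  have A[measurable]: "A \<in> sets (lborel \<Otimes>\<^sub>M lborel)" unfolding A_def by measurable
  have em: "emeasure lborel {s \<in> {0..t}. x + s *\<^sub>R v \<notin> K} = ennreal (m x)" for x
  proof -
    have "emeasure lborel {s \<in> {0..t}. x + s *\<^sub>R v \<notin> K} \<le> emeasure lborel {0..t}"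
      by (rule emeasure_mono) auto
    also have "\<dots> < top" using t by simp
    finally show ?thesis unfolding m_def
      by (intro emeasure_eq_ennreal_measure) auto
  qed
  have slice: "Pair x -` A = (if x \<in> B then {s \<in> {0..t}. x + s *\<^sub>R v \<notin> K} else {})" for x
    by (auto simp: A_def space_pair_measure)
  have slice2: "(\<lambda>x. (x, s)) -` A = (if s \<in> {0..t} then {x \<in> B. x + s *\<^sub>R v \<notin> K} else {})" for s
    by (auto simp: A_def space_pair_measure)
  have nn: "(\<integral>\<^sup>+x. ennreal (indicator B x * m x) \<partial>lborel) = emeasure (lborel \<Otimes>\<^sub>M lborel) A"
    unfolding lborel.emeasure_pair_measure_alt[OF A] slice
    by (intro nn_integral_cong) (simp add: em[symmetric] del: mem_Collect_eq atLeastAtMost_iff)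
  also have "\<dots> = (\<integral>\<^sup>+s. emeasure lborel ((\<lambda>x. (x, s)) -` A) \<partial>lborel)"
    by (rule lborel_pair.emeasure_pair_measure_alt2[OF A])
  also have "\<dots> \<le> (\<integral>\<^sup>+s. ennreal \<eta> * indicator {0..t} s \<partial>lborel)"
    using escape by (intro nn_integral_mono) (auto simp: slice2)
  also have "\<dots> = ennreal (\<eta> * t)"
    using t \<open>0 \<le> \<eta>\<close> by (simp add: nn_integral_cmult_indicator ennreal_mult)
  finally have nn_le: "(\<integral>\<^sup>+x. ennreal (indicator B x * m x) \<partial>lborel) \<le> ennreal (\<eta> * t)" .
  \<comment> \<open>Measurability of \<open>m\<close> on \<open>B\<close> is inherited from
    \<open>A\<close>, since its values there are the measures of the sections of
    \<open>A\<close>.\<close>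
  have "(\<lambda>x. emeasure lborel (Pair x -` A)) \<in> borel_measurable lborel"
    by (rule lborel.measurable_emeasure_Pair[OF A])
  then have "(\<lambda>x. enn2real (emeasure lborel (Pair x -` A))) \<in> borel_measurable lborel" by measurable
  also have "(\<lambda>x. enn2real (emeasure lborel (Pair x -` A))) = (\<lambda>x. indicator B x * m x)"
    by (auto simp: slice em[symmetric] m_def measure_def fun_eq_iff)
  finally have meas: "(\<lambda>x. indicator B x * m x) \<in> borel_measurable lborel" .
  have m0: "0 \<le> indicator B x * m x" for x by (auto simp: m_def)
  have int_m: "integrable lborel (\<lambda>x. indicator B x * m x)"
    using nn_le m0 by (intro integrableI_nonneg meas) (auto simp: le_less_trans)
  have int_le: "(LINT x|lborel. indicator B x * m x) \<le> \<eta> * t"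
    using nn_le m0 t \<open>0 \<le> \<eta>\<close>
    by (subst (asm) nn_integral_eq_integral[OF int_m]) auto
  have "(LINT x:B|lborel. f (x + t *\<^sub>R v) - f x) \<le> (LINT x|lborel. indicator B x * (r * t) + c * (indicator B x * m x))"
    unfolding set_lebesgue_integral_def
  proof (rule integral_mono)
    have "continuous_on B (\<lambda>x. f (x + t *\<^sub>R v) - f x)"
      by (intro continuous_intros continuous_on_compose2[OF cont]) auto
    then show "integrable lborel (\<lambda>x. indicat_real B x *\<^sub>R (f (x + t *\<^sub>R v) - f x))"
      by (rule borel_integrable_compact[OF B])
    show "integrable lborel (\<lambda>x. indicat_real B x * (r * t) + c * (indicat_real B x * m x))"
      using fB int_m by auto
    show "indicat_real B x *\<^sub>R (f (x + t *\<^sub>R v) - f x)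
        \<le> indicat_real B x * (r * t) + c * (indicat_real B x * m x)" for x
      using dini_less_segment[OF lip K slope c t, of x] by (auto simp: m_def indicator_def)
  qed
  also have "\<dots> = r * t * measure lborel B + c * (LINT x|lborel. indicator B x * m x)"
    using fB int_m by (subst Bochner_Integration.integral_add) auto
  also have "\<dots> \<le> r * t * measure lborel B + c * (\<eta> * t)"
    using int_le c by (intro add_left_mono mult_left_mono) auto
  finally show ?thesis by (simp add: mult_ac)
qed

lemma emeasure_lborel_translate:
  fixes A :: "'a::euclidean_space set"
  assumes "A \<in> sets borel"
  shows "emeasure lborel {x. x + u \<in> A} = emeasure lborel A"
proof -
  have "emeasure lborel A = emeasure (distr lborel borel ((+) u)) A"
    by (simp add: lborel_distr_plus)
  also have "\<dots> = emeasure lborel {x. x + u \<in> A}"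
    using assms by (subst emeasure_distr) (auto simp: vimage_def add.commute)
  finally show ?thesis by simp
qed

text \<open>Outer regularity gives an open \<open>U\<close> around \<open>K\<close> with
  \<open>U - K\<close> small. A translate of \<open>K\<close> by less than the margin
  \<open>d\<close> stays in \<open>U\<close>, so whatever leaves \<open>K\<close> lands in
  \<open>U - K\<close>.\<close>

lemma compact_translate_escape:
  fixes K :: "'a::euclidean_space set"
  assumes K: "compact K" and "\<eta> > 0"
  obtains d where "d > 0"
    "\<And>u. norm u < d \<Longrightarrow> emeasure lborel {x \<in> K. x + u \<notin> K} \<le> ennreal \<eta>"
proof -
  have bK[measurable]: "K \<in> sets borel" using compact_imp_closed[OF K] by auto
  then have "K \<in> sets lebesgue" by auto
  then obtain U where U: "open U" "K \<subseteq> U" "emeasure lebesgue (U - K) < ennreal \<eta>"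
    using sets_lebesgue_outer_open[of K \<eta>] \<open>\<eta> > 0\<close> by metis
  obtain d where d: "d > 0" "(\<Union>x\<in>K. ball x d) \<subseteq> U"
    using compact_subset_open_imp_ball_epsilon_subset[OF K U(1,2)] by blast
  have "emeasure lborel {x \<in> K. x + u \<notin> K} \<le> ennreal \<eta>" if "norm u < d" for u
  proof -
    have escaped: "{y. y - u \<in> K \<and> y \<notin> K} \<in> sets lborel" by measurable
    \<comment> \<open>Substituting \<open>y = x + u\<close> turns the escaping points into the part
      of the translate of \<open>K\<close> by \<open>u\<close> that lies outside
      \<open>K\<close>.\<close>
    have "emeasure lborel {x \<in> K. x + u \<notin> K} = emeasure lborel {x. x + u \<in> {y. y - u \<in> K \<and> y \<notin> K}}"
      by (simp cong: conj_cong)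
    also have "\<dots> = emeasure lborel {y. y - u \<in> K \<and> y \<notin> K}"
      by (intro emeasure_lborel_translate) measurable
    also have "\<dots> = emeasure lebesgue {y. y - u \<in> K \<and> y \<notin> K}"
      using escaped by simp
    also have "\<dots> \<le> emeasure lebesgue (U - K)"
    proof (rule emeasure_mono)
      have "y \<in> U" if "y - u \<in> K" for y
        using d(2) that \<open>norm u < d\<close> by (force simp: dist_norm)
      then show "{y. y - u \<in> K \<and> y \<notin> K} \<subseteq> U - K" by auto
      show "U - K \<in> sets lebesgue" using U(1) bK by auto
    qed
    finally show ?thesis using U(3) by simp
  qed
  then show ?thesis using d that by blast
qed

section \<open>Rademacher's theorem\<close>

text \<open>This is inner regularity. Intersecting with balls first makes the closed subsets that
  regularity yields compact.\<close>

lemma null_sets_lborelI_compact: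
  fixes S :: "'a::euclidean_space set"
  assumes S: "S \<in> sets borel" and null: "\<And>K. compact K \<Longrightarrow> K \<subseteq> S \<Longrightarrow> emeasure lborel K = 0"
  shows "S \<in> null_sets lborel"
proof -
  have "emeasure lborel (S \<inter> cball 0 (real n)) = 0" for n
  proof (rule antisym[OF ennreal_le_epsilon])
    fix e :: real assume "0 < e"
    have S': "S \<inter> cball 0 (real n) \<in> sets borel" using S by auto
    then have "S \<inter> cball 0 (real n) \<in> sets lebesgue" by simp
    then obtain T where T: "closed T" "T \<subseteq> S \<inter> cball 0 (real n)"
        "emeasure lebesgue (S \<inter> cball 0 (real n) - T) < ennreal e"
      using sets_lebesgue_inner_closed[OF _ \<open>0 < e\<close>] by metis
    have "compact T" using T by (metis bounded_cball bounded_subset compact_eq_bounded_closed le_inf_iff)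
    then have T0: "emeasure lborel T = 0" using null T by auto
    have rest: "S \<inter> cball 0 (real n) - T \<in> sets lborel" using S' T(1) by auto
    have "emeasure lborel (S \<inter> cball 0 (real n)) \<le> emeasure lborel (T \<union> (S \<inter> cball 0 (real n) - T))"
      using S T by (intro emeasure_mono) auto
    also have "\<dots> \<le> emeasure lborel T + emeasure lborel (S \<inter> cball 0 (real n) - T)"
      using S T by (intro emeasure_subadditive) auto
    also have "emeasure lborel (S \<inter> cball 0 (real n) - T) = emeasure lebesgue (S \<inter> cball 0 (real n) - T)"
      using rest by simp
    finally show "emeasure lborel (S \<inter> cball 0 (real n)) \<le> 0 + ennreal e" using T0 T(3) by auto
  qed auto
  then have "(\<Union>n::nat. S \<inter> cball 0 (real n)) \<in> null_sets lborel"
    using S by (intro null_sets_UN) (auto simp: null_sets_def)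
  also have "(\<Union>n::nat. S \<inter> cball 0 (real n)) = S"
    using real_arch_simple by auto
  finally show ?thesis .
qed

text \<open>For fixed \<open>t\<close> the inequality is open in \<open>x\<close>, and it has to
  hold for some \<open>t\<close> in each interval from 0 to \<open>inverse (real (Suc n))\<close>;
  so the set is a countable intersection of open sets.\<close>

lemma borel_dini_less:
  fixes f :: "'a::euclidean_space \<Rightarrow> real"
  assumes "continuous_on UNIV f"
  shows "{x. dini_less f v r x} \<in> sets borel"
proof -
  let ?O = "\<lambda>t. {x. f (x + t *\<^sub>R v) - f x < r * t}"
  have "open (?O t)" for t
    by (intro open_Collect_less continuous_intros continuous_on_compose2[OF assms]) auto
  moreover have "dini_less f v r x \<longleftrightarrow> (\<forall>n. \<exists>t\<in>{0<..<inverse (real (Suc n))}. x \<in> ?O t)" for x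
  proof
    assume dini: "dini_less f v r x"
    show "\<forall>n. \<exists>t\<in>{0<..<inverse (real (Suc n))}. x \<in> ?O t"
    proof
      fix n
      have "\<forall>\<^sub>F t in at_right 0. t \<in> {0<..<inverse (real (Suc n))}"
        by (intro eventually_at_right_real) auto
      from frequently_ex[OF frequently_eventually_conj[OF dini[unfolded dini_less_def] this]]
      show "\<exists>t\<in>{0<..<inverse (real (Suc n))}. x \<in> ?O t" by auto
    qed
  next
    assume ex: "\<forall>n. \<exists>t\<in>{0<..<inverse (real (Suc n))}. x \<in> ?O t"
    have "\<exists>y>0. y < b \<and> f (x + y *\<^sub>R v) - f x < r * y" if b: "b > 0" for b
    proof -
      obtain n where "inverse (real (Suc n)) < b" using reals_Archimedean[OF b] by auto
      moreover obtain t where "t \<in> {0<..<inverse (real (Suc n))}" "x \<in> ?O t" using ex by blast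
      ultimately show ?thesis by (intro exI[of _ t]) auto
    qed
    then show "dini_less f v r x"
      unfolding dini_less_def frequently_def eventually_at_right_field by blast
  qed
  then have "{x. dini_less f v r x} = (\<Inter>n. \<Union>t\<in>{0<..<inverse (real (Suc n))}. ?O t)" by auto
  ultimately show ?thesis by (simp only:) (intro sets.countable_INT'' borel_open open_UN ballI; simp)
qed

text \<open>Subadditivity of directional derivatives and, for \<open>w = 0\<close>, their existence. Integrate
  the increment from \<open>x\<close> to \<open>x + t (v + w)\<close>, split at \<open>x + t v\<close>, over \<open>K\<close>: the part of \<open>K\<close> that
  leaves \<open>K\<close> on the way is negligible for small \<open>t\<close>, so \<open>c |K| \<le> (a + b) |K|\<close>.\<close>

lemma compact_dini_additive_null:
  fixes f :: "'a::euclidean_space \<Rightarrow> real"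
  assumes lip: "L-lipschitz_on UNIV f" and K: "compact K" and abc: "a + b < c"
    and dini: "\<And>x. x \<in> K \<Longrightarrow> dini_less f v a x" "\<And>x. x \<in> K \<Longrightarrow> dini_less f w b x"
      "\<And>x. x \<in> K \<Longrightarrow> dini_less (\<lambda>x. - f x) (v + w) (- c) x"
  shows "emeasure lborel K = 0"
proof -
  have L0: "0 \<le> L" using lip by (rule lipschitz_on_nonneg)
  have cont: "continuous_on UNIV f" using lip by (rule lipschitz_on_continuous_on)
  have cont': "continuous_on S (\<lambda>x. f (x + u))" for u S
    by (intro continuous_on_compose2[OF cont] continuous_intros) auto
  have lip': "L-lipschitz_on UNIV (\<lambda>x. - f x)"
    using lip by (simp add: lipschitz_on_def dist_minus)
  have clK: "closed K" using K by (rule compact_imp_closed)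
  then have bK[measurable]: "K \<in> sets borel" by auto
  define \<mu> where "\<mu> = measure lborel K"
  \<comment> \<open>One constant that dominates all three slope excesses; the third concerns
    \<open>- f\<close>, whose rate is \<open>- c\<close>.\<close>
  define C where "C = \<bar>L * norm v - a\<bar> + \<bar>L * norm w - b\<bar> + \<bar>L * norm (v + w) + c\<bar>"
  have C: "0 \<le> C" "L * norm v - a \<le> C" "L * norm w - b \<le> C" "L * norm (v + w) - (- c) \<le> C"
    unfolding C_def by linarith+
  have main: "(c - a - b) * \<mu> \<le> 3 * C * \<eta>" if \<eta>: "\<eta> > 0" for \<eta>
  proof -
    obtain d where d: "d > 0" "\<And>u. norm u < d \<Longrightarrow> emeasure lborel {x \<in> K. x + u \<notin> K} \<le> ennreal \<eta>"
      using compact_translate_escape[OF K \<eta>] by blast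
    \<comment> \<open>So short that all displacements \<open>s *\<^sub>R v + s' *\<^sub>R w\<close>
      with \<open>s\<close> and \<open>s'\<close> up to \<open>t\<close> stay below
      \<open>d\<close>; the summand 1 keeps the denominator positive.\<close>
    define t where "t = d / (norm v + norm w + 1)"
    have t: "0 < t" unfolding t_def using d(1) by (intro divide_pos_pos add_nonneg_pos) auto
    have td: "t * norm v + t * norm w < d"
    proof -
      have "t * (norm v + norm w + 1) = d" 
        unfolding t_def using add_nonneg_pos[of "norm v + norm w" 1] by simp
      then show ?thesis using t by (simp add: algebra_simps)
    qed
    have small: "norm (s *\<^sub>R v + s' *\<^sub>R w) < d" if "s \<in> {0..t}" "s' \<in> {0..t}" for s s'
    proof -
      have "norm (s *\<^sub>R v + s' *\<^sub>R w) \<le> s * norm v + s' * norm w"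
        using that norm_triangle_ineq[of "s *\<^sub>R v" "s' *\<^sub>R w"] by simp
      also have "\<dots> \<le> t * norm v + t * norm w" using that by (intro add_mono mult_right_mono) auto
      finally show ?thesis using td by simp
    qed
    define K' where "K' = (+) (t *\<^sub>R v) ` K"
    have K': "compact K'" unfolding K'_def using K by (rule compact_translation)
    have memK': "x + t *\<^sub>R v \<in> K' \<longleftrightarrow> x \<in> K" for x unfolding K'_def by (auto simp: add.commute)
    have bK'[measurable]: "K' \<in> sets borel" using compact_imp_closed[OF K'] by auto
    have emK': "emeasure lborel {y \<in> K'. Q y} = emeasure lborel {x \<in> K. Q (x + t *\<^sub>R v)}"
      if [measurable]: "Measurable.pred borel Q" for Q
    proof -
      have "emeasure lborel {y \<in> K'. Q y} = emeasure lborel {x. x + t *\<^sub>R v \<in> {y \<in> K'. Q y}}"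
        by (intro emeasure_lborel_translate[symmetric]) measurable
      then show ?thesis by (simp add: memK')
    qed
    have mK': "measure lborel K' = \<mu>" using emK'[of "\<lambda>_. True"] by (simp add: \<mu>_def measure_def)
    have 1: "(LINT x:K|lborel. f (x + t *\<^sub>R v) - f x) \<le> a * t * \<mu> + C * t * \<eta>"
      unfolding \<mu>_def
      using small[of _ 0] t \<eta> d(2)
      by (intro integral_increment_le[OF lip clK K dini(1)] C) auto
    \<comment> \<open>The second leg starts in \<open>K'\<close>. Its position at time
      \<open>s\<close> is a point of \<open>K\<close> displaced by
      \<open>t *\<^sub>R v + s *\<^sub>R w\<close>, so the estimate for small translates of
      \<open>K\<close> applies again.\<close>
    have 2: "(LINT x:K'|lborel. f (x + t *\<^sub>R w) - f x) \<le> b * t * \<mu> + C * t * \<eta>"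
      unfolding mK'[symmetric]
    proof (intro integral_increment_le[OF lip clK K' dini(2)] C)
      fix s assume s: "s \<in> {0..t}"
      have "emeasure lborel {x \<in> K'. x + s *\<^sub>R w \<notin> K} = emeasure lborel {x \<in> K. x + (t *\<^sub>R v + s *\<^sub>R w) \<notin> K}"
        by (subst emK') (measurable, simp add: add.assoc)
      also have "\<dots> \<le> ennreal \<eta>" using s t by (intro d(2) small) auto
      finally show "emeasure lborel {x \<in> K'. x + s *\<^sub>R w \<notin> K} \<le> ennreal \<eta>" .
    qed (use t \<eta> in auto)
    have 3: "(LINT x:K|lborel. - f (x + t *\<^sub>R (v + w)) - - f x) \<le> (- c) * t * \<mu> + C * t * \<eta>"
      unfolding \<mu>_def
      using small t \<eta> d(2)
      by (intro integral_increment_le[OF lip' clK K dini(3)] C) (auto simp: scaleR_add_right)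
    have int: "set_integrable lborel K (\<lambda>x. f (x + u) - f (x + u'))" for u u'
      unfolding set_integrable_def
      by (intro borel_integrable_compact K continuous_intros cont')
    have "(LINT x:K'|lborel. f (x + t *\<^sub>R w) - f x)
        = (LINT x|distr lborel borel ((+) (t *\<^sub>R v)). indicator K' x *\<^sub>R (f (x + t *\<^sub>R w) - f x))"
      by (simp add: lborel_distr_plus set_lebesgue_integral_def)
    also have "\<dots> = (LINT x:K|lborel. f (x + t *\<^sub>R v + t *\<^sub>R w) - f (x + t *\<^sub>R v))"
      unfolding set_lebesgue_integral_def
    proof (subst integral_distr)
      have [measurable]: "f \<in> borel_measurable borel" using cont by (rule borel_measurable_continuous_onI)
      show "(\<lambda>x. indicat_real K' x *\<^sub>R (f (x + t *\<^sub>R w) - f x)) \<in> borel_measurable borel"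
        by measurable
      have "indicat_real K' (t *\<^sub>R v + x) = indicat_real K x" for x
        using memK'[of x] by (simp add: indicator_def add.commute)
      then show "(LINT x|lborel. indicat_real K' (t *\<^sub>R v + x) *\<^sub>R
             (f (t *\<^sub>R v + x + t *\<^sub>R w) - f (t *\<^sub>R v + x))) =
        (LINT x|lborel. indicat_real K x *\<^sub>R (f (x + t *\<^sub>R v + t *\<^sub>R w) - f (x + t *\<^sub>R v)))"
        by (simp add: add.commute)
    qed auto
    finally have "(LINT x:K|lborel. f (x + t *\<^sub>R v) - f x) + (LINT x:K'|lborel. f (x + t *\<^sub>R w) - f x)
      = (LINT x:K|lborel. (f (x + t *\<^sub>R v) - f x) + (f (x + t *\<^sub>R v + t *\<^sub>R w) - f (x + t *\<^sub>R v)))"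
      using int[of "t *\<^sub>R v" 0] int[of "t *\<^sub>R v + t *\<^sub>R w" "t *\<^sub>R v"]
      by (subst set_integral_add(2)) (auto simp: add.assoc)
    also have "\<dots> = - (LINT x:K|lborel. - f (x + t *\<^sub>R (v + w)) - - f x)"
      by (simp add: set_lebesgue_integral_def scaleR_add_right add.assoc flip: integral_minus)
        (simp add: algebra_simps)
    \<comment> \<open>The first two increments add up to the one from \<open>x\<close> to
      \<open>x + t *\<^sub>R (v + w)\<close>, and the third is its negative; so the left-hand sides
      of \<open>1\<close>, \<open>2\<close> and \<open>3\<close> sum to 0.\<close>
    finally have "0 \<le> (a * t * \<mu> + C * t * \<eta>) + (b * t * \<mu> + C * t * \<eta>) + ((- c) * t * \<mu> + C * t * \<eta>)"
      using 1 2 3 by linarith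
    then have "t * ((c - a - b) * \<mu>) \<le> t * (3 * C * \<eta>)" by (simp add: algebra_simps)
    then show ?thesis using t by simp
  qed
  have "(c - a - b) * \<mu> \<le> 0"
  proof (rule field_le_epsilon)
    fix e :: real assume "0 < e"
    then have "(c - a - b) * \<mu> \<le> 3 * C * (e / (3 * C + 1))" using C(1) by (intro main) auto
    also have "\<dots> \<le> e" using C(1) \<open>0 < e\<close> by (simp add: field_simps)
    finally show "(c - a - b) * \<mu> \<le> 0 + e" by simp
  qed
  then have "\<mu> = 0" using abc measure_nonneg[of lborel K] by (auto simp: \<mu>_def mult_le_0_iff)
  then show ?thesis
    using emeasure_compact_finite[OF K] by (auto simp: \<mu>_def measure_def enn2real_eq_0_iff)
qed

text \<open>Rational rates leave countably many exceptional sets, each Borel with null compact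
  subsets. The condition on \<open>- f\<close> says that \<open>f\<close> frequently grows faster
  than at rate \<open>c\<close> in direction \<open>v + w\<close>.\<close>

lemma AE_dini_additive:
  fixes f :: "'a::euclidean_space \<Rightarrow> real"
  assumes lip: "L-lipschitz_on UNIV f"
  shows "AE x in lborel. \<forall>a b c :: rat. a + b < c \<longrightarrow>
    \<not> (dini_less f v (of_rat a) x \<and> dini_less f w (of_rat b) x
      \<and> dini_less (\<lambda>x. - f x) (v + w) (- of_rat c) x)"
  unfolding AE_all_countable
proof (intro allI)
  fix a b c :: rat
  show "AE x in lborel. a + b < c \<longrightarrow> \<not> (dini_less f v (of_rat a) x \<and> dini_less f w (of_rat b) x
      \<and> dini_less (\<lambda>x. - f x) (v + w) (- of_rat c) x)"
  proof (cases "a + b < c")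
    case True
    let ?S = "{x. dini_less f v (of_rat a) x} \<inter> {x. dini_less f w (of_rat b) x}
      \<inter> {x. dini_less (\<lambda>x. - f x) (v + w) (- of_rat c) x}"
    have cont: "continuous_on UNIV f" using lip by (rule lipschitz_on_continuous_on)
    have "?S \<in> null_sets lborel"
    proof (rule null_sets_lborelI_compact)
      show "?S \<in> sets borel"
        using cont by (intro sets.Int borel_dini_less continuous_intros)
      show "emeasure lborel K = 0" if "compact K" "K \<subseteq> ?S" for K
        using that True
        by (intro compact_dini_additive_null[OF lip, of K "of_rat a" "of_rat b" "of_rat c" v w])
          (auto simp: of_rat_less simp flip: of_rat_add)
    qed
    then show ?thesis by (intro AE_I'[of ?S]) auto
  qed auto
qed

text \<open>The limit is the supremum of the eventual lower bounds: a number above it is not an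
  eventual lower bound, so by \<open>osc\<close> every larger number is an eventual upper
  bound.\<close>

lemma bounded_no_oscillation_tendsto:
  fixes q :: "'a \<Rightarrow> real"
  assumes F: "F \<noteq> bot" and bdd: "\<forall>\<^sub>F t in F. \<bar>q t\<bar> \<le> B"
    and osc: "\<And>a c. a < c \<Longrightarrow> (\<forall>\<^sub>F t in F. a \<le> q t) \<or> (\<forall>\<^sub>F t in F. q t \<le> c)"
  shows "\<exists>l. (q \<longlongrightarrow> l) F"
proof -
  define S where "S = {a. \<forall>\<^sub>F t in F. a \<le> q t}"
  have "- B \<in> S" unfolding S_def using bdd by (auto elim: eventually_mono)
  then have ne: "S \<noteq> {}" by auto
  have ub: "a \<le> B" if "a \<in> S" for a
  proof -
    have "\<forall>\<^sub>F t in F. a \<le> B"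
      using that bdd unfolding S_def by (auto elim: eventually_elim2)
    then show ?thesis using F by (simp add: eventually_const)
  qed
  then have bdd_S: "bdd_above S" by (auto simp: bdd_above_def)
  have "(q \<longlongrightarrow> Sup S) F"
  proof (rule order_tendstoI)
    fix a assume "a < Sup S"
    then obtain a' where "a' \<in> S" "a < a'" using less_cSup_iff[OF ne bdd_S] by auto
    then show "\<forall>\<^sub>F t in F. a < q t" unfolding S_def by (auto elim: eventually_mono)
  next
    fix c assume c: "Sup S < c"
    obtain a where a: "Sup S < a" "a < c" using dense[OF c] by auto
    obtain c' where c': "a < c'" "c' < c" using dense[OF a(2)] by auto
    have "a \<notin> S" using a(1) cSup_upper[OF _ bdd_S] by force
    then have "\<forall>\<^sub>F t in F. q t \<le> c'" using osc[OF c'(1)] by (auto simp: S_def)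
    then show "\<forall>\<^sub>F t in F. q t < c" using c' by (auto elim: eventually_mono)
  qed
  then show ?thesis ..
qed

section \<open>Right directional derivatives almost everywhere\<close>

text \<open>One-sided to match \<open>dini_less\<close>; homogeneity is therefore immediate only for
  positive factors.\<close>

definition has_dir_deriv :: "('a::real_vector \<Rightarrow> real) \<Rightarrow> 'a \<Rightarrow> 'a \<Rightarrow> real \<Rightarrow> bool" where
  "has_dir_deriv f v x l \<longleftrightarrow> ((\<lambda>t. (f (x + t *\<^sub>R v) - f x) / t) \<longlongrightarrow> l) (at_right 0)"

lemma has_dir_deriv_unique: "has_dir_deriv f v x l \<Longrightarrow> has_dir_deriv f v x l' \<Longrightarrow> l = l'"
  unfolding has_dir_deriv_def by (rule tendsto_unique[rotated]) auto

lemma has_dir_deriv_0: "has_dir_deriv f 0 x 0"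
  by (simp add: has_dir_deriv_def)

lemma has_dir_deriv_uminus: "has_dir_deriv f v x l \<Longrightarrow> has_dir_deriv (\<lambda>x. - f x) v x (- l)"
  unfolding has_dir_deriv_def by (drule tendsto_minus) (simp add: minus_divide_left)

lemma has_dir_deriv_scaleR:
  assumes "has_dir_deriv f v x l" "0 < c"
  shows "has_dir_deriv f (c *\<^sub>R v) x (c * l)"
proof -
  have "filterlim (\<lambda>t. c * t) (at_right 0) (at_right (0::real))"
    unfolding filterlim_at
    using assms(2) by (auto intro!: tendsto_eq_intros eventually_mono[OF eventually_at_right_less])
  from filterlim_compose[OF assms(1)[unfolded has_dir_deriv_def] this]
  have "((\<lambda>t. c * ((f (x + (c * t) *\<^sub>R v) - f x) / (c * t))) \<longlongrightarrow> c * l) (at_right 0)"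
    by (intro tendsto_intros)
  then show ?thesis unfolding has_dir_deriv_def using assms(2) by (simp add: mult.commute)
qed

lemma has_dir_deriv_imp_dini_less:
  assumes "has_dir_deriv f v x l" "l < r"
  shows "dini_less f v r x"
proof -
  have "\<forall>\<^sub>F t in at_right 0. (f (x + t *\<^sub>R v) - f x) / t < r"
    using assms unfolding has_dir_deriv_def by (rule order_tendstoD)
  then have "\<forall>\<^sub>F t in at_right 0. f (x + t *\<^sub>R v) - f x < r * t"
    using eventually_at_right_less[of 0] by eventually_elim (simp add: field_simps)
  then show ?thesis unfolding dini_less_def by (intro eventually_frequently) auto
qed

text \<open>If the quotient oscillated, it would be frequently below a rational \<open>a'\<close>
  and frequently above a larger rational \<open>c'\<close>, against additivity for the directions
  \<open>v\<close> and 0.\<close>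

lemma AE_has_dir_deriv:
  fixes f :: "'a::euclidean_space \<Rightarrow> real"
  assumes lip: "L-lipschitz_on UNIV f"
  shows "AE x in lborel. \<exists>l. has_dir_deriv f v x l"
  using AE_dini_additive[OF lip, of v 0]
proof eventually_elim
  case (elim x)
  let ?q = "\<lambda>t. (f (x + t *\<^sub>R v) - f x) / t"
  show ?case unfolding has_dir_deriv_def
  proof (rule bounded_no_oscillation_tendsto)
    show "\<forall>\<^sub>F t in at_right 0. \<bar>?q t\<bar> \<le> L * norm v"
      using eventually_at_right_less[of 0]
    proof eventually_elim
      case (elim t)
      then show ?case
        using lipschitz_onD[OF lip, of "x + t *\<^sub>R v" x] by (simp add: dist_norm field_simps)
    qed
  next
    fix a c :: real assume "a < c"
    then obtain a' where a': "a < of_rat a'" "of_rat a' < c" using of_rat_dense by blast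
    obtain c' where c': "of_rat a' < (of_rat c' :: real)" "of_rat c' < c" using of_rat_dense[OF a'(2)] by blast
    then have "a' < c'" by (simp add: of_rat_less)
    show "(\<forall>\<^sub>F t in at_right 0. a \<le> ?q t) \<or> (\<forall>\<^sub>F t in at_right 0. ?q t \<le> c)"
    proof (rule ccontr)
      assume *: "\<not> ?thesis"
      have "dini_less f v (of_rat a') x" unfolding dini_less_def frequently_def
      proof
        assume "\<forall>\<^sub>F t in at_right 0. \<not> f (x + t *\<^sub>R v) - f x < of_rat a' * t"
        then have "\<forall>\<^sub>F t in at_right 0. a \<le> ?q t"
          using eventually_at_right_less[of 0]
        proof eventually_elim
          case (elim t)
          have "a * t \<le> of_rat a' * t" using a' elim by (intro mult_right_mono) auto
          then have "a * t \<le> f (x + t *\<^sub>R v) - f x" using elim by linarith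
          then show ?case using elim by (simp add: pos_le_divide_eq)
        qed
        then show False using * by auto
      qed
      moreover have "dini_less (\<lambda>x. - f x) v (- of_rat c') x" unfolding dini_less_def frequently_def
      proof
        assume "\<forall>\<^sub>F t in at_right 0. \<not> - f (x + t *\<^sub>R v) - - f x < - of_rat c' * t"
        then have "\<forall>\<^sub>F t in at_right 0. ?q t \<le> c"
          using eventually_at_right_less[of 0]
        proof eventually_elim
          case (elim t)
          have "of_rat c' * t \<le> c * t" using c' elim by (intro mult_right_mono) auto
          then have "f (x + t *\<^sub>R v) - f x \<le> c * t" using elim by linarith
          then show ?case using elim by (simp add: pos_divide_le_eq)
        qed
        then show False using * by auto
      qed
      \<comment> \<open>The derivative in direction 0 is 0, so any positive rate is allowed; half of
        the gap keeps the sum of the rates below \<open>c'\<close>.\<close>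
      moreover have "dini_less f 0 (of_rat ((c' - a') / 2)) x"
        using \<open>a' < c'\<close> by (intro has_dir_deriv_imp_dini_less[OF has_dir_deriv_0]) simp
      moreover have "a' + (c' - a') / 2 < c'" using \<open>a' < c'\<close> by (simp add: field_simps)
      ultimately show False using elim by auto
    qed
  qed auto
qed

text \<open>Unspecified where the limit does not exist, which for Lipschitz \<open>f\<close> and
  fixed \<open>v\<close> happens only on a null set.\<close>

definition dir_deriv :: "('a::real_vector \<Rightarrow> real) \<Rightarrow> 'a \<Rightarrow> 'a \<Rightarrow> real" where
  "dir_deriv f v x = (THE l. has_dir_deriv f v x l)"

lemma dir_deriv_eq: "has_dir_deriv f v x l \<Longrightarrow> dir_deriv f v x = l"
  unfolding dir_deriv_def using has_dir_deriv_unique by blast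

lemma AE_has_dir_deriv_dir_deriv:
  fixes f :: "'a::euclidean_space \<Rightarrow> real"
  assumes lip: "L-lipschitz_on UNIV f"
  shows "AE x in lborel. has_dir_deriv f v x (dir_deriv f v x)"
  using AE_has_dir_deriv[OF lip, of v] by eventually_elim (auto simp: dir_deriv_eq)

text \<open>If \<open>l3\<close> exceeded \<open>l1 + l2\<close>, rationals within a third of the
  gap from the three values would be rates that \<open>AE_dini_additive\<close> excludes.\<close>

lemma AE_has_dir_deriv_le:
  fixes f :: "'a::euclidean_space \<Rightarrow> real"
  assumes lip: "L-lipschitz_on UNIV f"
  shows "AE x in lborel. \<forall>l1 l2 l3. has_dir_deriv f v x l1 \<longrightarrow> has_dir_deriv f w x l2
    \<longrightarrow> has_dir_deriv f (v + w) x l3 \<longrightarrow> l3 \<le> l1 + l2"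
  using AE_dini_additive[OF lip, of v w]
proof eventually_elim
  case (elim x)
  show ?case
  proof (intro allI impI, rule ccontr)
    fix l1 l2 l3 assume l: "has_dir_deriv f v x l1" "has_dir_deriv f w x l2" "has_dir_deriv f (v + w) x l3"
      and "\<not> l3 \<le> l1 + l2"
    then have e: "(l3 - l1 - l2) / 3 > 0" by simp
    obtain a where a: "l1 < of_rat a" "of_rat a < l1 + (l3 - l1 - l2) / 3"
      using of_rat_dense[of l1 "l1 + (l3 - l1 - l2) / 3"] e by auto
    obtain b where b: "l2 < of_rat b" "of_rat b < l2 + (l3 - l1 - l2) / 3"
      using of_rat_dense[of l2 "l2 + (l3 - l1 - l2) / 3"] e by auto
    obtain c where c: "l3 - (l3 - l1 - l2) / 3 < of_rat c" "of_rat c < l3"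
      using of_rat_dense[of "l3 - (l3 - l1 - l2) / 3" l3] e by auto
    have "of_rat a + of_rat b < (of_rat c :: real)" using a b c by (simp add: field_simps)
    then have "a + b < c" by (simp add: of_rat_less flip: of_rat_add)
    moreover have "dini_less (\<lambda>x. - f x) (v + w) (- of_rat c) x"
      using c by (intro has_dir_deriv_imp_dini_less[OF has_dir_deriv_uminus[OF l(3)]]) simp
    ultimately show False
      using elim has_dir_deriv_imp_dini_less[OF l(1) a(1)] has_dir_deriv_imp_dini_less[OF l(2) b(1)] by blast
  qed
qed

text \<open>Subadditivity for \<open>f\<close> gives one inequality, subadditivity for
  \<open>- f\<close> the other.\<close>

lemma AE_dir_deriv_add:
  fixes f :: "'a::euclidean_space \<Rightarrow> real"
  assumes lip: "L-lipschitz_on UNIV f"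
  shows "AE x in lborel. dir_deriv f (v + w) x = dir_deriv f v x + dir_deriv f w x"
proof -
  have "L-lipschitz_on UNIV (\<lambda>x. - f x)"
    using lip by (simp add: lipschitz_on_def dist_minus)
  from AE_has_dir_deriv_le[OF this, of v w] AE_has_dir_deriv_le[OF lip, of v w]
    AE_has_dir_deriv_dir_deriv[OF lip, of v] AE_has_dir_deriv_dir_deriv[OF lip, of w] AE_has_dir_deriv_dir_deriv[OF lip, of "v + w"]
  show ?thesis
  proof eventually_elim
    case (elim x)
    have "- dir_deriv f (v + w) x \<le> - dir_deriv f v x + - dir_deriv f w x"
      using elim(1) elim(3-5)[THEN has_dir_deriv_uminus] by blast
    moreover have "dir_deriv f (v + w) x \<le> dir_deriv f v x + dir_deriv f w x" using elim by auto
    ultimately show ?case by simp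
  qed
qed

text \<open>A positive factor only rescales \<open>t\<close>. For negative \<open>c\<close>,
  additivity for \<open>c *\<^sub>R v\<close> and \<open>(- c) *\<^sub>R v\<close>, whose sum is 0,
  reduces to the factor \<open>- c\<close>.\<close>

lemma AE_dir_deriv_scaleR:
  fixes f :: "'a::euclidean_space \<Rightarrow> real"
  assumes lip: "L-lipschitz_on UNIV f"
  shows "AE x in lborel. dir_deriv f (c *\<^sub>R v) x = c * dir_deriv f v x"
proof -
  have 0: "dir_deriv f 0 x = 0" for x by (rule dir_deriv_eq[OF has_dir_deriv_0])
  have pos: "AE x in lborel. dir_deriv f (c *\<^sub>R v) x = c * dir_deriv f v x" if "c > 0" for c
    using AE_has_dir_deriv_dir_deriv[OF lip, of v]
    by eventually_elim (intro dir_deriv_eq has_dir_deriv_scaleR that)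
  consider "c = 0" | "c > 0" | "c < 0" by linarith
  then show ?thesis
  proof cases
    case 3
    then have "- c > 0" by simp
    from AE_dir_deriv_add[OF lip, of "c *\<^sub>R v" "(- c) *\<^sub>R v"] pos[OF this]
    show ?thesis by eventually_elim (simp add: 0)
  qed (simp_all add: 0 pos)
qed

lemma AE_dir_deriv_sum:
  fixes f :: "'a::euclidean_space \<Rightarrow> real"
  assumes lip: "L-lipschitz_on UNIV f" and "finite F"
  shows "AE x in lborel. dir_deriv f (\<Sum>b\<in>F. c b *\<^sub>R b) x = (\<Sum>b\<in>F. c b * dir_deriv f b x)"
  using assms(2)
proof induction
  case empty
  then show ?case by (simp add: dir_deriv_eq[OF has_dir_deriv_0])
next
  case (insert b F)
  from insert.IH AE_dir_deriv_scaleR[OF lip, of "c b" b]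
    AE_dir_deriv_add[OF lip, of "c b *\<^sub>R b" "\<Sum>b\<in>F. c b *\<^sub>R b"]
  show ?case by eventually_elim (simp add: insert.hyps)
qed

text \<open>Expanding \<open>v\<close> in the basis shows that the vector of partial derivatives
  acts as a gradient. The exceptional null set still depends on \<open>v\<close>.\<close>

lemma AE_has_dir_deriv_inner:
  fixes f :: "'a::euclidean_space \<Rightarrow> real"
  assumes lip: "L-lipschitz_on UNIV f"
  shows "AE x in lborel. has_dir_deriv f v x (v \<bullet> (\<Sum>b\<in>Basis. dir_deriv f b x *\<^sub>R b))"
  using AE_has_dir_deriv_dir_deriv[OF lip, of v] AE_dir_deriv_sum[OF lip finite_Basis, of "\<lambda>b. v \<bullet> b"]
  by eventually_elim (simp add: euclidean_representation inner_sum_right mult.commute)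

section \<open>From directional derivatives to differentiability\<close>

text \<open>By compactness, finitely many directions from \<open>Q\<close> approximate all unit
  vectors. Their difference quotients converge uniformly, and the Lipschitz bound controls the
  directions in between.\<close>

lemma has_derivative_if_has_dir_deriv_dense:
  fixes f :: "'a::euclidean_space \<Rightarrow> real"
  assumes lip: "L-lipschitz_on UNIV f"
    and dense: "\<And>X. open X \<Longrightarrow> X \<noteq> {} \<Longrightarrow> \<exists>v\<in>Q. v \<in> X"
    and dir_deriv: "\<And>v. v \<in> Q \<Longrightarrow> has_dir_deriv f v x (v \<bullet> a)"
  shows "(f has_derivative (\<lambda>h. h \<bullet> a)) (at x)"
  unfolding has_derivative_at_alt
proof (intro conjI allI impI)
  show "bounded_linear (\<lambda>h. h \<bullet> a)" by (rule bounded_linear_inner_left)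
  fix e :: real assume "0 < e"
  have L: "0 \<le> L" using lip by (rule lipschitz_on_nonneg)
  \<comment> \<open>Three errors add up, with weights 1, \<open>L\<close> and \<open>norm a\<close>:
    the difference quotient along the chosen direction \<open>v\<close>, and the replacement of
    \<open>u\<close> by \<open>v\<close> in \<open>f\<close> and in the linear map.\<close>
  define e' where "e' = e / (1 + L + norm a)"
  have "0 < 1 + L + norm a" using L norm_ge_zero[of a] by linarith
  then have e': "0 < e'" "(1 + L + norm a) * e' = e"
    unfolding e'_def using \<open>0 < e\<close> by auto
  have "sphere 0 1 \<subseteq> (\<Union>v\<in>Q. ball v e')"
  proof
    fix u :: 'a
    obtain v where "v \<in> Q" "v \<in> ball u e'" using dense[of "ball u e'"] e' by auto
    then show "u \<in> (\<Union>v\<in>Q. ball v e')" by (auto simp: dist_commute)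
  qed
  then obtain F where F: "F \<subseteq> Q" "finite F" "sphere 0 1 \<subseteq> (\<Union>v\<in>F. ball v e')"
    by (rule compactE_image[OF compact_sphere open_ball])
  have "\<forall>\<^sub>F t in at_right 0. \<forall>v\<in>F. dist ((f (x + t *\<^sub>R v) - f x) / t) (v \<bullet> a) < e'"
    using F dir_deriv e' by (intro eventually_ball_finite ballI tendstoD) (auto simp: has_dir_deriv_def)
  then obtain d where d: "d > 0"
    "\<And>t v. 0 < t \<Longrightarrow> t < d \<Longrightarrow> v \<in> F \<Longrightarrow> dist ((f (x + t *\<^sub>R v) - f x) / t) (v \<bullet> a) < e'"
    unfolding eventually_at_right_field by auto
  have "norm (f y - f x - (y - x) \<bullet> a) \<le> e * norm (y - x)" if y: "norm (y - x) < d" for y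
  proof (cases "y = x")
    case False
    define t where "t = norm (y - x)"
    define u where "u = (y - x) /\<^sub>R t"
    have t: "0 < t" "t < d" using False y by (auto simp: t_def)
    have yu: "y = x + t *\<^sub>R u" using t by (simp add: u_def)
    have "u \<in> sphere 0 1" using t by (simp add: u_def t_def)
    then obtain v where v: "v \<in> F" "norm (u - v) < e'"
      using F(3) by (auto simp: dist_norm norm_minus_commute)
    have 1: "\<bar>f (x + t *\<^sub>R v) - f x - t * (v \<bullet> a)\<bar> \<le> t * e'"
    proof -
      have "f (x + t *\<^sub>R v) - f x - t * (v \<bullet> a) = t * ((f (x + t *\<^sub>R v) - f x) / t - v \<bullet> a)"
        using t by (simp add: field_simps)
      then show ?thesis using d(2)[OF t v(1)] t by (simp add: abs_mult dist_real_def)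
    qed
    have 2: "\<bar>f (x + t *\<^sub>R u) - f (x + t *\<^sub>R v)\<bar> \<le> L * (t * e')"
    proof -
      have "\<bar>f (x + t *\<^sub>R u) - f (x + t *\<^sub>R v)\<bar> \<le> L * norm (t *\<^sub>R (u - v))"
        using lipschitz_onD[OF lip, of "x + t *\<^sub>R u" "x + t *\<^sub>R v"]
        by (simp add: dist_norm scaleR_diff_right)
      also have "\<dots> \<le> L * (t * e')"
        using L t v by (intro mult_left_mono) auto
      finally show ?thesis .
    qed
    have 3: "\<bar>t * (v \<bullet> a) - t * (u \<bullet> a)\<bar> \<le> norm a * (t * e')"
    proof -
      have "\<bar>t * (v \<bullet> a) - t * (u \<bullet> a)\<bar> = t * \<bar>(u - v) \<bullet> a\<bar>"
      proof -
        have "t * (v \<bullet> a) - t * (u \<bullet> a) = - (t * ((u - v) \<bullet> a))"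
          by (simp add: inner_diff_left algebra_simps)
        then show ?thesis using t by (simp add: abs_mult)
      qed
      also have "\<dots> \<le> t * (norm (u - v) * norm a)"
        using t by (intro mult_left_mono Cauchy_Schwarz_ineq2) auto
      also have "\<dots> \<le> t * (e' * norm a)"
        using t v by (intro mult_left_mono mult_right_mono) auto
      finally show ?thesis by (simp add: mult_ac)
    qed
    have "norm (f y - f x - (y - x) \<bullet> a) = \<bar>f (x + t *\<^sub>R u) - f x - t * (u \<bullet> a)\<bar>"
      using t by (simp add: yu)
    also have "\<dots> \<le> t * e' + L * (t * e') + norm a * (t * e')" using 1 2 3 by linarith
    also have "\<dots> = ((1 + L + norm a) * e') * t" by (simp add: algebra_simps)
    finally show ?thesis by (simp add: e' t_def)
  qed simp
  then show "\<exists>d>0. \<forall>y. norm (y - x) < d \<longrightarrow> norm (f y - f x - (y - x) \<bullet> a) \<le> e * norm (y - x)"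
    using d(1) by blast
qed

text \<open>A countable dense set of directions has a common exceptional null set and suffices for
  differentiability.\<close>

lemma rademacher_real:
  fixes f :: "'a::euclidean_space \<Rightarrow> real"
  assumes lip: "L-lipschitz_on UNIV f"
  shows "AE x in lborel. f differentiable (at x)"
proof -
  obtain Q :: "'a set" where Q: "countable Q" "\<And>X. open X \<Longrightarrow> X \<noteq> {} \<Longrightarrow> \<exists>v\<in>Q. v \<in> X"
    using countable_dense_exists by blast
  have "AE x in lborel. \<forall>v\<in>Q. has_dir_deriv f v x (v \<bullet> (\<Sum>b\<in>Basis. dir_deriv f b x *\<^sub>R b))"
    using AE_has_dir_deriv_inner[OF lip] by (subst AE_ball_countable[OF Q(1)]) auto
  then show ?thesis
  proof eventually_elim
    case (elim x)
    then have "(f has_derivative (\<lambda>h. h \<bullet> (\<Sum>b\<in>Basis. dir_deriv f b x *\<^sub>R b))) (at x)"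
      by (intro has_derivative_if_has_dir_deriv_dense[OF lip Q(2)]) auto
    then show ?case unfolding differentiable_def by blast
  qed
qed

theorem rademacher:
  fixes f :: "'a::euclidean_space \<Rightarrow> 'b::euclidean_space"
  assumes lip: "L-lipschitz_on UNIV f"
  shows "AE x in lborel. f differentiable (at x)"
proof -
  have "L-lipschitz_on UNIV (\<lambda>x. f x \<bullet> b)" if "b \<in> Basis" for b
  proof (rule lipschitz_onI)
    fix x y
    have "\<bar>(f x - f y) \<bullet> b\<bar> \<le> norm (f x - f y)" using that by (rule Basis_le_norm)
    then show "dist (f x \<bullet> b) (f y \<bullet> b) \<le> L * dist x y"
      using lipschitz_onD[OF lip, of x y] by (simp add: dist_norm inner_diff_left)
  qed (use lip in \<open>rule lipschitz_on_nonneg\<close>)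
  then have "AE x in lborel. \<forall>b\<in>Basis. (\<lambda>x. f x \<bullet> b) differentiable (at x)"
    by (intro AE_finite_allI finite_Basis rademacher_real)
  then show ?thesis by eventually_elim (rule differentiable_componentwise_within[THEN iffD2])
qed

section \<open>Lipschitz constants on balls from derivative bounds\<close>

text \<open>If the increment from \<open>x\<close> to \<open>y\<close> were too long, so would be the increments by \<open>v = y - x\<close> from
  all points of a small ball around \<open>x\<close>, contradicting the bound on their average: almost all of the
  moving ball lies in a closed set on which the derivative in direction \<open>v\<close> is small.\<close>

lemma lipschitz_on_cball_if_derivative_bounded:
  fixes f :: "'a::euclidean_space \<Rightarrow> 'b::euclidean_space"
  assumes lip: "L-lipschitz_on UNIV f" and M: "0 \<le> M" and d: "0 < d"
    and deriv: "\<And>z D. z \<in> ball x0 d \<Longrightarrow> (f has_derivative D) (at z) \<Longrightarrow> onorm D \<le> M"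
  shows "M-lipschitz_on (cball x0 d) f"
proof -
  have contf: "continuous_on UNIV f" using lip by (rule lipschitz_on_continuous_on)
  have "M-lipschitz_on (ball x0 d) f"
  proof (rule lipschitz_onI[OF _ M])
    fix x y assume x: "x \<in> ball x0 d" and y: "y \<in> ball x0 d"
    show "dist (f x) (f y) \<le> M * dist x y"
    proof (rule ccontr)
      assume violated: "\<not> dist (f x) (f y) \<le> M * dist x y"
      define v where "v = y - x"
      define u where "u = f y - f x"
      \<comment> \<open>A scalar function that grows by \<open>(norm u)\<^sup>2\<close> from
        \<open>x\<close> to \<open>y\<close>, although its derivative along \<open>v\<close>, where
        it exists in the ball, is at most the smaller number
        \<open>norm u * (M * norm v)\<close>.\<close>
      define g where "g z = u \<bullet> f z" for z
      have gt: "M * norm v < norm u"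
        using violated by (simp add: v_def u_def dist_norm norm_minus_commute)
      have u0: "0 < norm u" using gt M by (meson mult_nonneg_nonneg norm_ge_zero order_le_less_trans)
      have lipg: "(norm u * L)-lipschitz_on UNIV g"
      proof (rule lipschitz_onI)
        fix z z'
        have "\<bar>u \<bullet> (f z - f z')\<bar> \<le> norm u * norm (f z - f z')" by (rule Cauchy_Schwarz_ineq2)
        also have "\<dots> \<le> norm u * (L * norm (z - z'))"
          using lipschitz_onD[OF lip, of z z'] by (intro mult_left_mono) (auto simp: dist_norm)
        finally show "dist (g z) (g z') \<le> norm u * L * dist z z'"
          by (simp add: g_def dist_norm inner_diff_right mult.assoc)
      qed (use lipschitz_on_nonneg[OF lip] in auto)
      have "norm u * (M * norm v) < (norm u)\<^sup>2" using gt u0 by (simp add: power2_eq_square)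
      \<comment> \<open>Two levels in the gap: \<open>r\<close> bounds the slopes of
        \<open>g\<close> from above, \<open>r'\<close> its increments by \<open>v\<close> near
        \<open>x\<close> from below.\<close>
      then obtain r where r: "norm u * (M * norm v) < r" "r < (norm u)\<^sup>2" using dense by blast
      obtain r' where r': "r < r'" "r' < (norm u)\<^sup>2" using dense[OF r(2)] by blast
      have "(norm u)\<^sup>2 = g (x + v) - g x"
        by (simp add: g_def v_def u_def dot_square_norm flip: inner_diff_right)
      moreover have "continuous_on UNIV (\<lambda>z. g (z + v) - g z)"
        unfolding g_def by (intro continuous_intros continuous_on_compose2[OF contf]) auto
      then have "open {z. r' < g (z + v) - g z}"
        by (intro open_Collect_less continuous_on_const)
      ultimately obtain \<rho>1 where \<rho>1: "\<rho>1 > 0" "cball x \<rho>1 \<subseteq> {z. r' < g (z + v) - g z}"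
        using r'(2) open_contains_cball by (metis mem_Collect_eq)
      obtain \<rho>2 where \<rho>2: "\<rho>2 > 0" "cball x \<rho>2 \<subseteq> ball x0 d"
        using x open_contains_cball_eq[OF open_ball] by blast
      obtain \<rho>3 where \<rho>3: "\<rho>3 > 0" "cball y \<rho>3 \<subseteq> ball x0 d"
        using y open_contains_cball_eq[OF open_ball] by blast
      \<comment> \<open>\<open>\<rho>1\<close> keeps the increments above \<open>r'\<close>;
        \<open>\<rho>2\<close> and \<open>\<rho>3\<close> keep \<open>B\<close> and its translate by
        \<open>v\<close>, hence by convexity the segments between them, in the ball around
        \<open>x0\<close>.\<close>
      define \<rho> where "\<rho> = min \<rho>1 (min \<rho>2 \<rho>3)"
      have \<rho>: "\<rho> > 0" using \<rho>1 \<rho>2 \<rho>3 by (simp add: \<rho>_def)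
      define B where "B = cball x \<rho>"
      have B: "compact B" unfolding B_def by simp
      have Bg: "r' < g (z + v) - g z" if "z \<in> B" for z
        using \<rho>1(2) that by (auto simp: B_def \<rho>_def)
      have Bseg: "z + s *\<^sub>R v \<in> ball x0 d" if z: "z \<in> B" and s: "s \<in> {0..1}" for z s
      proof -
        have "z \<in> ball x0 d" using \<rho>2(2) z by (auto simp: B_def \<rho>_def)
        moreover have "z + v \<in> cball y \<rho>3"
          using z by (auto simp: B_def \<rho>_def v_def dist_norm algebra_simps)
        then have "z + v \<in> ball x0 d" using \<rho>3(2) by auto
        ultimately have "(1 - s) *\<^sub>R z + s *\<^sub>R (z + v) \<in> ball x0 d"
          using s by (intro convexD[OF convex_ball]) auto
        then show ?thesis by (simp add: algebra_simps)
      qed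
      have fB: "emeasure lborel B < \<infinity>" using B by (rule emeasure_compact_finite)
      have \<mu>: "0 < measure lborel B"
        unfolding B_def using content_cball_pos[OF \<rho>] by simp
      define C where "C = \<bar>norm u * L * norm v - r\<bar> + 1"
      \<comment> \<open>Makes \<open>C * \<eta>\<close> half of
        \<open>(r' - r) * measure lborel B\<close>, whereas the two bounds on the integrated
        increment will make it at least the whole.\<close>
      define \<eta> where "\<eta> = (r' - r) * measure lborel B / (2 * C)"
      have C: "0 < C" by (simp add: C_def)
      have \<eta>: "0 < \<eta>" unfolding \<eta>_def using r' \<mu> C by simp
      obtain N where N: "N \<in> null_sets lborel" "{z. \<not> f differentiable (at z)} \<subseteq> N"
        using rademacher[OF lip] by (auto elim!: AE_E simp: null_sets_def)
      define S where "S = ball x0 d - N"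
      have S: "S \<in> sets lborel" unfolding S_def using N by auto
      then obtain K where K: "closed K" "K \<subseteq> S" "emeasure lebesgue (S - K) < ennreal \<eta>"
        using sets_lebesgue_inner_closed[OF sets_completionI_sets[OF S] \<eta>] by metis
      have SK: "S - K \<in> sets lborel" using S K by auto
      then have emSK: "emeasure lborel (S - K) \<le> ennreal \<eta>" using K(3) by simp
      have slope: "dini_less g v r z" if "z \<in> K" for z
      proof -
        have z: "z \<in> ball x0 d" "f differentiable (at z)" using that K(2) N(2) by (auto simp: S_def)
        then obtain D where D: "(f has_derivative D) (at z)" unfolding differentiable_def by blast
        have bl: "bounded_linear D" using D by (rule has_derivative_bounded_linear)
        have "norm (D v) \<le> M * norm v"
          using onorm[OF bl, of v] deriv[OF z(1) D] by (meson mult_right_mono norm_ge_zero order_trans)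
        then have "u \<bullet> D v \<le> norm u * (M * norm v)"
          using norm_cauchy_schwarz[of u "D v"] by (meson mult_left_mono norm_ge_zero order_trans)
        then have "u \<bullet> D v < r" using r by simp
        have g': "(g has_derivative (\<lambda>h. u \<bullet> D h)) (at z)"
          unfolding g_def by (intro has_derivative_inner_right D)
        have "((\<lambda>t. g (z + t *\<^sub>R v)) has_derivative (\<lambda>t. u \<bullet> D (t *\<^sub>R v))) (at 0)"
        proof (rule has_derivative_compose[where g = g and f = "\<lambda>t. z + t *\<^sub>R v", THEN has_derivative_eq_rhs])
          show "((\<lambda>t. z + t *\<^sub>R v) has_derivative (\<lambda>t. t *\<^sub>R v)) (at 0)"
            by (auto intro!: derivative_eq_intros)
          show "(g has_derivative (\<lambda>h. u \<bullet> D h)) (at (z + 0 *\<^sub>R v))" using g' by simp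
        qed simp
        then have "((\<lambda>t. g (z + t *\<^sub>R v)) has_field_derivative (u \<bullet> D v)) (at 0)"
          by (simp add: has_field_derivative_def linear_scale[OF bounded_linear.linear[OF bl]] mult.commute[of _ "u \<bullet> D v"])
        then have "((\<lambda>t. (g (z + t *\<^sub>R v) - g z) / t) \<longlongrightarrow> u \<bullet> D v) (at 0)"
          by (simp add: DERIV_def)
        then have "has_dir_deriv g v z (u \<bullet> D v)"
          unfolding has_dir_deriv_def by (rule tendsto_mono[rotated]) (rule at_le, simp)
        then show ?thesis using \<open>u \<bullet> D v < r\<close> by (rule has_dir_deriv_imp_dini_less)
      qed
      \<comment> \<open>The moving point stays in the ball around \<open>x0\<close>, so when it is
        outside \<open>K\<close> it lies in \<open>S - K\<close> or in \<open>N\<close>; translation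
        invariance bounds the measure of such starting points by \<open>\<eta>\<close>.\<close>
      have "(LINT z:B|lborel. g (z + 1 *\<^sub>R v) - g z) \<le> r * 1 * measure lborel B + C * 1 * \<eta>"
      proof (rule integral_increment_le[OF lipg K(1) B slope])
        fix s :: real assume s: "s \<in> {0..1}"
        have W: "(S - K) \<union> N \<in> sets borel" using SK N by auto
        have "emeasure lborel {z \<in> B. z + s *\<^sub>R v \<notin> K} \<le> emeasure lborel {z. z + s *\<^sub>R v \<in> (S - K) \<union> N}"
        proof (rule emeasure_mono)
          show "{z \<in> B. z + s *\<^sub>R v \<notin> K} \<subseteq> {z. z + s *\<^sub>R v \<in> (S - K) \<union> N}"
            using Bseg s by (auto simp: S_def)
          show "{z. z + s *\<^sub>R v \<in> (S - K) \<union> N} \<in> sets lborel" using W by measurable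
        qed
        also have "\<dots> = emeasure lborel ((S - K) \<union> N)" using W by (rule emeasure_lborel_translate)
        also have "\<dots> = emeasure lborel (S - K)" using SK N(1) by (rule emeasure_Un_null_set)
        finally show "emeasure lborel {z \<in> B. z + s *\<^sub>R v \<notin> K} \<le> ennreal \<eta>" using emSK by simp
      qed (use \<eta> in \<open>auto simp: C_def\<close>)
      moreover have "r' * measure lborel B \<le> (LINT z:B|lborel. g (z + 1 *\<^sub>R v) - g z)"
      proof -
        have "r' * measure lborel B = (LINT z:B|lborel. r')"
          using fB by (simp add: set_lebesgue_integral_def B_def mult.commute)
        also have "\<dots> \<le> (LINT z:B|lborel. g (z + 1 *\<^sub>R v) - g z)"
        proof (rule set_integral_mono)
          show "set_integrable lborel B (\<lambda>z. r')"
            unfolding set_integrable_def by (intro borel_integrable_compact B continuous_on_const)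
          have "continuous_on B (\<lambda>z. g (z + 1 *\<^sub>R v) - g z)"
            unfolding g_def by (intro continuous_intros continuous_on_compose2[OF contf]) auto
          then show "set_integrable lborel B (\<lambda>z. g (z + 1 *\<^sub>R v) - g z)"
            unfolding set_integrable_def by (rule borel_integrable_compact[OF B])
        qed (use Bg in \<open>auto intro: less_imp_le\<close>)
        finally show ?thesis .
      qed
      ultimately have "(r' - r) * measure lborel B \<le> C * \<eta>" by (simp add: algebra_simps)
      also have "C * \<eta> = (r' - r) * measure lborel B / 2" using C by (simp add: \<eta>_def)
      finally show False using r' \<mu> by (simp add: mult_le_0_iff)
    qed
  qed
  \<comment> \<open>Continuity carries the constant over to the closed ball, so derivatives are only
    examined in the open one.\<close>
  then have "M-lipschitz_on (closure (ball x0 d)) f"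
    using contf by (intro lipschitz_on_closure) (auto intro: continuous_on_subset)
  then show ?thesis using d by simp
qed

section \<open>The generalization bound\<close>

lemma closed_supp: "closed (supp P)"
proof -
  have "- supp P = \<Union>{U. open U \<and> emeasure P U = 0}" by (auto simp: supp_def zero_less_iff_neq_zero)
  then show ?thesis by (metis (mono_tags, lifting) closed_def mem_Collect_eq open_Union)
qed

text \<open>The complement of the support is a union of open null sets, and by Lindelof countably
  many of them cover it.\<close>

lemma AE_supp:
  fixes P :: "'a::second_countable_topology measure"
  assumes "sets P = sets borel"
  shows "AE x in P. x \<in> supp P"
proof -
  have eq: "- supp P = \<Union>{U. open U \<and> emeasure P U = 0}" by (auto simp: supp_def zero_less_iff_neq_zero)
  obtain \<U> where \<U>: "\<U> \<subseteq> {U. open U \<and> emeasure P U = 0}" "countable \<U>"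
      "\<Union>\<U> = \<Union>{U. open U \<and> emeasure P U = 0}"
    using Lindelof[of "{U. open U \<and> emeasure P U = 0}"] by auto
  have "(\<Union>U\<in>\<U>. U) \<in> null_sets P"
    using \<U> assms by (intro null_sets_UN') (auto simp: null_sets_def)
  then have "- supp P \<in> null_sets P" using eq \<U> by simp
  then show ?thesis by (rule AE_I') auto
qed

text \<open>The infimum is attained: every difference quotient is a lower bound of the set of
  Lipschitz constants.\<close>

lemma lipschitz_on_Lip_norm:
  assumes "\<exists>L. L-lipschitz_on (supp P) g"
  shows "(Lip_norm P g)-lipschitz_on (supp P) g"
proof (rule lipschitz_onI)
  have ne: "{L. L-lipschitz_on (supp P) g} \<noteq> {}" using assms by auto
  show "0 \<le> Lip_norm P g"
    unfolding Lip_norm_def using ne by (intro cInf_greatest) (auto dest: lipschitz_on_nonneg)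
  fix x y assume xy: "x \<in> supp P" "y \<in> supp P"
  show "dist (g x) (g y) \<le> Lip_norm P g * dist x y"
  proof (cases "x = y")
    case False
    then have "dist (g x) (g y) / dist x y \<le> Lip_norm P g"
      unfolding Lip_norm_def using ne xy
      by (intro cInf_greatest) (auto simp: divide_le_eq dest: lipschitz_onD)
    then show ?thesis using False by (simp add: divide_le_eq)
  qed simp
qed

text \<open>Boundedness of \<open>g\<close> on \<open>S\<close> bounds the differences from above,
  so that the real-valued \<open>SUP\<close> is a genuine supremum.\<close>

lemma norm_diff_le_local_variation:
  assumes "bounded (g ` S)" "x \<in> S" "y \<in> S"
  shows "norm (g x - g y) \<le> local_variation S g"
proof -
  obtain b where b: "\<And>z. z \<in> S \<Longrightarrow> norm (g z) \<le> b" using assms(1) by (auto simp: bounded_iff)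
  have "norm (g z - g z') \<le> b + b" if "z \<in> S" "z' \<in> S" for z z'
    using norm_triangle_ineq4[of "g z" "g z'"] b that by (meson add_mono order_trans)
  then have "bdd_above ((\<lambda>(x, y). norm (g x - g y)) ` (S \<times> S))"
    by (intro bdd_aboveI2[of _ _ "b + b"]) auto
  then show ?thesis
    unfolding local_variation_def using assms(2,3)
    by (intro cSUP_upper2[of _ _ "(x, y)"]) auto
qed

text \<open>A derivative of \<open>f\<close> at a point \<open>z\<close> of the ball can only be
  \<open>J z\<close>, with \<open>z\<close> in \<open>A\<close>, and \<open>J z\<close> differs from
  \<open>J x\<close> by at most the local variation.\<close>

lemma lipschitz_on_cball_local_variation:
  fixes f :: "'a::euclidean_space \<Rightarrow> 'b::euclidean_space"
  assumes lip: "L-lipschitz_on UNIV f" and J: "jacobian_version f A J" and x: "x \<in> A" and d: "0 < d"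
  shows "(norm (J x) + local_variation (cball x d \<inter> A) J)-lipschitz_on (cball x d) f"
proof (rule lipschitz_on_cball_if_derivative_bounded[OF lip _ d])
  have bdd: "bounded (J ` (cball x d \<inter> A))" using J compact_cball unfolding jacobian_version_def by blast
  have x': "x \<in> cball x d \<inter> A" using x d by simp
  show "0 \<le> norm (J x) + local_variation (cball x d \<inter> A) J"
    using norm_diff_le_local_variation[OF bdd x' x'] by simp
  fix z D assume z: "z \<in> ball x d" and D: "(f has_derivative D) (at z)"
  then have "f differentiable (at z)" unfolding differentiable_def by blast
  then have zA: "z \<in> A" and "(f has_derivative blinfun_apply (J z)) (at z)"
    using J unfolding jacobian_version_def by auto
  then have "onorm D = norm (J z)"
    using has_derivative_unique[OF D] by (simp add: norm_blinfun.rep_eq)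
  also have "\<dots> \<le> norm (J x) + norm (J z - J x)" by (rule norm_triangle_sub)
  also have "\<dots> \<le> norm (J x) + local_variation (cball x d \<inter> A) J"
    using norm_diff_le_local_variation[OF bdd _ x', of z] z zA by auto
  finally show "onorm D \<le> norm (J x) + local_variation (cball x d \<inter> A) J" .
qed

section \<open>Random samples and the expected error\<close>

theorem theorem6p1:
  fixes P :: "(real ^ 'd) measure"
    and \<delta> :: "nat \<Rightarrow> real \<Rightarrow> real"
    and fstar :: "real ^ 'd \<Rightarrow> real ^ 'e"
    and N :: nat and \<epsilon> :: real
  assumes "prob_space P" and "sets P = sets borel"
    and "delta_good \<delta> P"
    and "\<exists>L. L-lipschitz_on (supp P) fstar"
    and "N \<ge> 1" and "0 < \<epsilon>" and "\<epsilon> < 1"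
  shows "with_prob_at_least (1 - \<epsilon>) (iid_samples N P)
    (\<lambda>x. \<forall>(f :: real ^ 'd \<Rightarrow> real ^ 'e) A J.
       (\<exists>L. L-lipschitz_on UNIV f) \<longrightarrow>
       (\<forall>i\<in>{1..N}. f (x i) = fstar (x i)) \<longrightarrow>
       jacobian_version f A J \<longrightarrow> (\<forall>i\<in>{1..N}. x i \<in> A) \<longrightarrow>
       (LINT y:supp P|P. norm (f y - fstar y))
         \<le> \<delta> N \<epsilon> * (Lip_norm P fstar +
             (MAX i\<in>{1..N}. norm (J (x i)) + local_variation (cball (x i) (\<delta> N \<epsilon>) \<inter> A) J)))"
proof -
  interpret prob_space P by fact
  let ?M = "iid_samples N P" and ?d = "\<delta> N \<epsilon>"
  have d: "0 < ?d" using assms by (auto simp: delta_good_def rate_function_def)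
  obtain E where E: "E \<in> sets ?M" "measure ?M E \<ge> 1 - \<epsilon>"
      "\<And>x. x \<in> E \<Longrightarrow> supp P \<subseteq> (\<Union>i\<in>{1..N}. cball (x i) ?d)"
    using assms(3,5-7) by (fastforce simp: delta_good_def with_prob_at_least_def)
  \<comment> \<open>Covering alone does not place the samples in the support, but
    \<open>fstar\<close> is controlled only there. This extra event has probability 1.\<close>
  define W where "W = {x \<in> space ?M. \<forall>i\<in>{1..N}. x i \<in> supp P}"
  have supp[measurable]: "supp P \<in> sets P" using assms(2) closed_supp[of P] by auto
  have W: "W \<in> sets ?M" unfolding W_def iid_samples_def by measurable
  have "AE x in ?M. \<forall>i\<in>{1..N}. x i \<in> supp P"
    unfolding iid_samples_def
    by (intro AE_finite_allI AE_PiM_component assms(1) AE_supp assms(2)) auto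
  then have "measure ?M (E \<inter> W) = measure ?M E"
    using E(1) W by (intro measure_eq_AE) (auto simp: W_def elim!: eventually_mono)
  then have "measure ?M (E \<inter> W) \<ge> 1 - \<epsilon>" using E(2) by simp
  moreover have "(LINT y:supp P|P. norm (f y - fstar y))
         \<le> ?d * (Lip_norm P fstar +
             (MAX i\<in>{1..N}. norm (J (x i)) + local_variation (cball (x i) ?d \<inter> A) J))"
    if x: "x \<in> E \<inter> W" and lip: "\<exists>L. L-lipschitz_on UNIV f"
      and eq: "\<forall>i\<in>{1..N}. f (x i) = fstar (x i)"
      and J: "jacobian_version f A J" "\<forall>i\<in>{1..N}. x i \<in> A"
    for x and f :: "real ^ 'd \<Rightarrow> real ^ 'e" and A J
  proof -
    define m where "m i = norm (J (x i)) + local_variation (cball (x i) ?d \<inter> A) J" for i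
    define B where "B = ?d * (Lip_norm P fstar + (MAX i\<in>{1..N}. m i))"
    have m_max: "m i \<le> (MAX i\<in>{1..N}. m i)" if "i \<in> {1..N}" for i
      using that by (intro Max_ge) auto
    have m_lip: "(m i)-lipschitz_on (cball (x i) ?d) f" if "i \<in> {1..N}" for i
      unfolding m_def using lip J that d by (auto intro: lipschitz_on_cball_local_variation)
    have lip_star: "(Lip_norm P fstar)-lipschitz_on (supp P) fstar"
      using assms(4) by (rule lipschitz_on_Lip_norm)
    have "0 \<le> m 1" using m_lip[of 1] \<open>N \<ge> 1\<close> by (intro lipschitz_on_nonneg) auto
    then have max0: "0 \<le> (MAX i\<in>{1..N}. m i)" using m_max[of 1] \<open>N \<ge> 1\<close> by (meson atLeastAtMost_iff order_refl order_trans)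
    have B0: "0 \<le> B"
      unfolding B_def using max0 d lipschitz_on_nonneg[OF lip_star]
      by (intro mult_nonneg_nonneg add_nonneg_nonneg) auto
    have bound: "norm (f y - fstar y) \<le> B" if y: "y \<in> supp P" for y
    proof -
      obtain i where i: "i \<in> {1..N}" "y \<in> cball (x i) ?d" using E(3)[of x] x y by blast
      have xi: "x i \<in> supp P" using x i(1) by (auto simp: W_def)
      \<comment> \<open>The detour through the sample \<open>x i\<close>, where \<open>f\<close> and
        \<open>fstar\<close> agree, splits the error into one increment of each function.\<close>
      have "norm (f y - fstar y) \<le> dist (f y) (f (x i)) + dist (fstar (x i)) (fstar y)"
        using eq i(1) dist_triangle[of "f y" "fstar y" "f (x i)"] by (simp add: dist_norm)
      also have "\<dots> \<le> m i * dist y (x i) + Lip_norm P fstar * dist (x i) y"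
        using i d xi y by (intro add_mono lipschitz_onD[OF m_lip] lipschitz_onD[OF lip_star]) auto
      also have "\<dots> \<le> (MAX i\<in>{1..N}. m i) * ?d + Lip_norm P fstar * ?d"
        using i m_max[OF i(1)] lipschitz_on_nonneg[OF m_lip[OF i(1)]] lipschitz_on_nonneg[OF lip_star] max0
        by (intro add_mono mult_mono) (auto simp: dist_commute)
      finally show ?thesis by (simp add: B_def algebra_simps)
    qed
    \<comment> \<open>An integrable integrand bounded by \<open>B\<close> has mean at most
      \<open>B\<close> under a probability measure; otherwise the Bochner integral is 0 by
      convention and \<open>B0\<close> applies.\<close>
    have "(LINT y:supp P|P. norm (f y - fstar y)) \<le> B"
    proof (cases "integrable P (\<lambda>y. indicator (supp P) y *\<^sub>R norm (f y - fstar y))")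
      case True
      then show ?thesis unfolding set_lebesgue_integral_def
        using B0 bound by (intro integral_le_const AE_I2) (auto simp: indicator_def)
    next
      case False
      then show ?thesis unfolding set_lebesgue_integral_def
        using B0 by (simp add: not_integrable_integral_eq)
    qed
    then show ?thesis by (simp add: B_def m_def)
  qed
  ultimately show ?thesis
    unfolding with_prob_at_least_def using E(1) W by (intro bexI[of _ "E \<inter> W"]) auto
qed

end
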